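(* Let $\mathbf A\in\mathbb R^{m\times n}$ be nonzero and $\mathbf b\in\mathbb R^m$. Let $\varepsilon>0$ and $0<\alpha_{\rm r}<\dfrac{2}{(1+\varepsilon)\lambda_{\max}^{\rm r}}$. If the linear system $\mathbf A\mathbf x=\mathbf b$ is inconsistent, then for arbitrary $\mathbf x^0\in\mathbb R^n$ and every $k\ge0$, the $k$th iterate $\mathbf x^k$ of the block row sampling iterative (BRSI) algorithm with stepsize $\alpha_{\rm r}$ satisfies $$\mathbb E\left[\|\mathbf x^k-\mathbf x_\star^0\|^2\right]\leq \eta_\varepsilon^k\|\mathbf x^0-\mathbf x_\star^0\|^2+\frac{\alpha_{\rm r}(1+1/\varepsilon)\gamma(1-\eta_\varepsilon^k)}{(2-\alpha_{\rm r}(1+\varepsilon)\lambda_{\max}^{\rm r})\sigma_{\min}^2(\mathbf A)},$$ where $$\eta_\varepsilon=1-\alpha_{\rm r}(2-\alpha_{\rm r}(1+\varepsilon)\lambda_{\max}^{\rm r})\sigma_{\min}^2(\mathbf A)\quad\text{and}\quad \gamma=\mathbb E\left[\|\mathbf A^\top\mathbf S\mathbf S^\top(\mathbf A\mathbf A^\dagger\mathbf b-\mathbf b)\|^2\right],$$ with $\mathbf S\sim\mathcal D_{\rm r}$.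
   Context: Notation: $\|\cdot\|$ is the Euclidean norm, $\mathbf A^\dagger$ is the Moore--Penrose pseudoinverse, $\sigma_{\min}(\mathbf A)$ is the smallest nonzero singular value of $\mathbf A$, and $\lambda_{\max}(\cdot)$ is the largest eigenvalue of a symmetric matrix. Define $\mathbf x_\star^0:=\mathbf A^\dagger\mathbf b+(\mathbf I-\mathbf A^\dagger\mathbf A)\mathbf x^0$. BRSI algorithm: let $\mathcal D_{\rm r}$ be a (discrete or continuous) distribution of random real matrices $\mathbf S$ with $m$ rows (the number of columns may itself be random) such that $\mathbb E[\mathbf S\mathbf S^\top]=\mathbf I$. Given $\mathbf x^0\in\mathbb R^n$ (deterministic) and a stepsize $\alpha_{\rm r}>0$, for $k\ge1$, $$\mathbf x^k=\mathbf x^{k-1}-\alpha_{\rm r}\mathbf A^\top\mathbf S\mathbf S^\top(\mathbf A\mathbf x^{k-1}-\mathbf b),$$ where at each iteration a fresh $\mathbf S\sim\mathcal D_{\rm r}$ is drawn, independently of all previous iterations. Define $\lambda_{\max}^{\rm r}=\max_{\mathbf S\sim\mathcal D_{\rm r}}\lambda_{\max}(\mathbf A^\top\mathbf S\mathbf S^\top\mathbf A)$, the maximum being over the possible realizations of $\mathbf S$; this maximum is assumed to exist (in particular to be finite). *)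

theory Defs
  imports "HOL-Probability.Probability"
begin

definition eigenvalues :: "real^'n^'n \<Rightarrow> real set" where
  "eigenvalues M = {\<mu>. \<exists>v. v \<noteq> 0 \<and> M *v v = \<mu> *\<^sub>R v}"

definition lambda_max :: "real^'n^'n \<Rightarrow> real" where
  "lambda_max M = Max (eigenvalues M)"

definition singular_values :: "real^'n^'m \<Rightarrow> real set" where
  "singular_values A = sqrt ` eigenvalues (transpose A ** A)"

definition sigma_min :: "real^'n^'m \<Rightarrow> real" where
  "sigma_min A = Min (singular_values A - {0})"

definition is_pseudoinverse :: "real^'n^'m \<Rightarrow> real^'m^'n \<Rightarrow> bool" where
  "is_pseudoinverse A X \<longleftrightarrow>
     A ** X ** A = A \<and> X ** A ** X = X \<and>
     transpose (A ** X) = A ** X \<and> transpose (X ** A) = X ** A"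

definition pseudoinverse :: "real^'n^'m \<Rightarrow> real^'m^'n" where
  "pseudoinverse A = (THE X. is_pseudoinverse A X)"

definition x_star :: "real^'n^'m \<Rightarrow> real^'m \<Rightarrow> real^'n \<Rightarrow> real^'n" where
  "x_star A b x0 = pseudoinverse A *v b + (mat 1 - pseudoinverse A ** A) *v x0"

text \<open>
  A matrix whose rows are indexed by \<^typ>\<open>'m\<close> and whose number of columns is arbitrary (so that it
  may be random) is encoded as the list of its columns. The entry in row \<open>i\<close> and column \<open>l\<close> of
  \<open>S\<close> is \<open>S ! l $ i\<close>.
\<close>

type_synonym 'm colmat = "(real^'m) list"

definition mult_transpose :: "'m::finite colmat \<Rightarrow> real^'m^'m" where
  "mult_transpose S = (\<chi> i j. \<Sum>l<length S. (S ! l) $ i * (S ! l) $ j)"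

text \<open>
  The space of these matrices is the disjoint union, over the number of columns \<open>q\<close>, of the
  Euclidean spaces of matrices with \<open>q\<close> columns. Its Borel sets are those generated by the number
  of columns and by the columns themselves (padded with zero columns).
\<close>

definition colmat_borel :: "'m::finite colmat measure" where
  "colmat_borel =
     vimage_algebra UNIV
       (\<lambda>S. (length S, \<lambda>l. if l < length S then S ! l else 0))
       (count_space UNIV \<Otimes>\<^sub>M (\<Pi>\<^sub>M l\<in>(UNIV :: nat set). (borel :: (real^'m) measure)))"

definition colmat_ball :: "'m::finite colmat \<Rightarrow> real \<Rightarrow> 'm colmat set" where
  "colmat_ball S e = {T. length T = length S \<and> (\<forall>l<length S. dist (T ! l) (S ! l) < e)}"

text \<open>
  The possible realizations of a random matrix with distribution \<open>D\<close> form the support of \<open>D\<close>: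
  every neighbourhood has positive probability.
\<close>

definition realizations :: "'m::finite colmat measure \<Rightarrow> 'm colmat set" where
  "realizations D = {S. \<forall>e>0. measure D (colmat_ball S e) > 0}"

definition lambda_max_values :: "'m::finite colmat measure \<Rightarrow> real^'n^'m \<Rightarrow> real set" where
  "lambda_max_values D A =
     (\<lambda>S. lambda_max (transpose A ** mult_transpose S ** A)) ` realizations D"

text \<open>
  \<^const>\<open>Max\<close> is meaningful only on finite sets, hence \<open>GREATEST\<close>. That the maximum exists has to
  be assumed separately.
\<close>

definition lambda_max_r :: "'m::finite colmat measure \<Rightarrow> real^'n^'m \<Rightarrow> real" where
  "lambda_max_r D A = (GREATEST y. y \<in> lambda_max_values D A)"

text \<open>
  The sample indexed by \<open>k\<close> is the one used in the step from iterate \<open>k\<close> to iterate \<open>k + 1\<close>.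
\<close>

primrec brsi :: "real^'n^'m \<Rightarrow> real^'m \<Rightarrow> real \<Rightarrow> real^'n \<Rightarrow> (nat \<Rightarrow> 'm::finite colmat) \<Rightarrow> nat \<Rightarrow> real^'n"
where
  "brsi A b \<alpha> x0 S 0 = x0"
| "brsi A b \<alpha> x0 S (Suc k) =
     brsi A b \<alpha> x0 S k
       - \<alpha> *\<^sub>R ((transpose A ** mult_transpose (S k)) *v (A *v brsi A b \<alpha> x0 S k - b))"

definition eta :: "'m::finite colmat measure \<Rightarrow> real^'n^'m \<Rightarrow> real \<Rightarrow> real \<Rightarrow> real" where
  "eta D A \<alpha> \<epsilon> = 1 - \<alpha> * (2 - \<alpha> * (1 + \<epsilon>) * lambda_max_r D A) * (sigma_min A)\<^sup>2"

definition gamma :: "'m::finite colmat measure \<Rightarrow> real^'n^'m \<Rightarrow> real^'m \<Rightarrow> real" where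
  "gamma D A b =
     (LINT S|D. (norm ((transpose A ** mult_transpose S) *v (A *v (pseudoinverse A *v b) - b)))\<^sup>2)"

end

theory Submission
  imports Defs
begin

text \<open>
  The error \<open>e\<^sub>k = x\<^sup>k - x\<^sub>\<star>\<close> stays in the range of \<open>A\<^sup>T\<close>, on which \<open>\<parallel>A e\<parallel> \<ge> \<sigma>\<^sub>m\<^sub>i\<^sub>n \<parallel>e\<parallel>\<close>. With
  \<open>G = A\<^sup>T S S\<^sup>T A\<close>, \<open>h = A\<^sup>T S S\<^sup>T r\<close> and \<open>r = A A\<^sup>\<dagger> b - b\<close>, one step is \<open>e \<mapsto> e - \<alpha> (G e + h)\<close>. Young's
  inequality separates \<open>G e\<close> from \<open>h\<close>, and \<open>\<parallel>G e\<parallel>\<^sup>2 \<le> \<lambda> \<langle>e, G e\<rangle>\<close> almost surely because \<open>S\<close> almost surely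
  lies in the support of its distribution. Taking expectations with \<open>E[S S\<^sup>T] = I\<close> turns
  \<open>\<langle>e, G e\<rangle>\<close> into \<open>\<parallel>A e\<parallel>\<^sup>2\<close> and kills the cross term \<open>\<langle>e, h\<rangle>\<close>, as \<open>A\<^sup>T r = 0\<close>. This gives
  \<open>E\<parallel>e\<^sub>k\<^sub>+\<^sub>1\<parallel>\<^sup>2 \<le> \<eta> E\<parallel>e\<^sub>k\<parallel>\<^sup>2 + \<alpha>\<^sup>2 (1 + 1/\<epsilon>) \<gamma>\<close>, which can be iterated since
  \<open>\<sigma>\<^sub>m\<^sub>i\<^sub>n\<^sup>2 \<le> \<lambda>\<close> forces \<open>\<eta> \<ge> 0\<close>.
\<close>

section \<open>Rayleigh quotients of symmetric matrices\<close>

text \<open>Compactness gives a minimiser of the quadratic form on the unit sphere of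
  \<open>V\<close>, and a first-order variation shows that it is an eigenvector. The invariant
  subspace is a parameter because two are used: the whole space (for \<open>lambda_max\<close>) and
  the range of \<open>transpose A\<close> (for \<open>sigma_min\<close>).\<close>

lemma eigenvector_of_Rayleigh_minimum:
  fixes M :: "real^'n^'n"
  assumes sym: "transpose M = M" and V: "subspace V" "V \<noteq> {0}"
    and inv: "\<And>x. x \<in> V \<Longrightarrow> M *v x \<in> V"
  obtains v \<mu> where "v \<in> V" "v \<noteq> 0" "M *v v = \<mu> *\<^sub>R v"
    "\<And>x. x \<in> V \<Longrightarrow> \<mu> * (norm x)\<^sup>2 \<le> x \<bullet> (M *v x)"
proof -
  let ?S = "V \<inter> sphere 0 1"
  obtain w where "w \<in> V" "w \<noteq> 0"
    using V subspace_0 by blast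
  then have "(1 / norm w) *\<^sub>R w \<in> ?S"
    using V by (auto simp: subspace_scale)
  then have "?S \<noteq> {}"
    by blast
  moreover have "compact ?S"
    using closed_subspace[OF V(1)] by (intro closed_Int_compact) auto
  moreover have "continuous_on ?S (\<lambda>x. x \<bullet> (M *v x))"
    by (intro continuous_intros linear_continuous_on matrix_vector_mul_bounded_linear)
  ultimately obtain v where v: "v \<in> ?S" and min: "\<And>x. x \<in> ?S \<Longrightarrow> v \<bullet> (M *v v) \<le> x \<bullet> (M *v x)"
    using continuous_attains_inf[of ?S "\<lambda>x. x \<bullet> (M *v x)"] by blast
  define \<mu> where "\<mu> = v \<bullet> (M *v v)"
  have vV: "v \<in> V" and nv: "norm v = 1"
    using v by auto
  have Rayleigh: "\<mu> * (norm x)\<^sup>2 \<le> x \<bullet> (M *v x)" if "x \<in> V" for x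
  proof (cases "x = 0")
    case False
    then have "(1 / norm x) *\<^sub>R x \<in> ?S"
      using that V by (auto simp: subspace_scale)
    from min[OF this] have "\<mu> \<le> (1 / norm x) * ((1 / norm x) * (x \<bullet> (M *v x)))"
      by (simp add: \<mu>_def matrix_vector_mult_scaleR)
    with False show ?thesis
      by (simp add: field_simps power2_eq_square)
  qed auto
  \<comment> \<open>The residual of the eigenvalue equation serves as the direction of variation;
    invariance of \<open>V\<close> makes it admissible.\<close>
  define w where "w = M *v v - \<mu> *\<^sub>R v"
  have wV: "w \<in> V"
    using V vV inv by (simp add: w_def subspace_diff subspace_scale)
  have "w = 0"
  proof (rule ccontr)
    assume "w \<noteq> 0"
    then have pos: "w \<bullet> w > 0"
      by simp
    let ?q = "w \<bullet> (M *v w) - \<mu> * (w \<bullet> w)"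
    have wMv: "v \<bullet> (M *v w) = w \<bullet> (M *v v)"
      by (metis dot_lmul_matrix inner_commute sym transpose_matrix_vector)
    have ww: "w \<bullet> w = w \<bullet> (M *v v) - \<mu> * (w \<bullet> v)"
      by (subst (2) w_def) (simp add: inner_diff_right)
    have le: "0 \<le> 2 * t * (w \<bullet> w) + t\<^sup>2 * ?q" for t
    proof -
      have "v + t *\<^sub>R w \<in> V"
        using V vV wV by (simp add: subspace_add subspace_scale)
      from Rayleigh[OF this]
      have "\<mu> * (v \<bullet> v + 2 * t * (w \<bullet> v) + t\<^sup>2 * (w \<bullet> w))
          \<le> v \<bullet> (M *v v) + t * (v \<bullet> (M *v w)) + t * (w \<bullet> (M *v v)) + t\<^sup>2 * (w \<bullet> (M *v w))"
        unfolding power2_norm_eq_inner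
        by (simp add: matrix_vector_right_distrib matrix_vector_mult_scaleR inner_add_left
            inner_add_right algebra_simps power2_eq_square inner_commute)
      moreover have "v \<bullet> v = 1"
        using nv by (simp add: norm_eq_1)
      ultimately show ?thesis
        unfolding wMv ww by (simp add: algebra_simps \<mu>_def)
    qed
    \<comment> \<open>With this \<open>t\<close>, the quadratic term costs at most half of what the
      linear term gains, so \<open>le\<close> fails at \<open>t\<close>.\<close>
    define t where "t = - (w \<bullet> w) / (\<bar>?q\<bar> + 1)"
    have "t < 0"
      using pos by (simp add: t_def divide_neg_pos)
    have "t\<^sup>2 * ?q \<le> t\<^sup>2 * \<bar>?q\<bar>"
      by (intro mult_left_mono) auto
    also have "\<dots> \<le> t\<^sup>2 * (\<bar>?q\<bar> + 1)"
      by (intro mult_left_mono) auto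
    also have "\<dots> = - t * (w \<bullet> w)"
      by (simp add: t_def power2_eq_square)
    finally have "2 * t * (w \<bullet> w) + t\<^sup>2 * ?q \<le> t * (w \<bullet> w)"
      by simp
    moreover have "t * (w \<bullet> w) < 0"
      using \<open>t < 0\<close> pos by (simp add: mult_neg_pos)
    ultimately show False
      using le[of t] by linarith
  qed
  then have "M *v v = \<mu> *\<^sub>R v"
    by (simp add: w_def)
  moreover have "v \<noteq> 0"
    using nv by auto
  ultimately show thesis
    using that vV Rayleigh by blast
qed

text \<open>Eigenvectors for distinct eigenvalues are orthogonal, hence independent. Finiteness is
  what gives meaning to the \<open>Max\<close> and \<open>Min\<close> in \<open>lambda_max\<close>
  and \<open>sigma_min\<close>.\<close>

lemma finite_eigenvalues_symmetric:
  fixes M :: "real^'n^'n"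
  assumes sym: "transpose M = M"
  shows "finite (eigenvalues M)"
proof -
  define f where "f \<mu> = (SOME v. v \<noteq> 0 \<and> M *v v = \<mu> *\<^sub>R v)" for \<mu>
  have f: "f \<mu> \<noteq> 0 \<and> M *v f \<mu> = \<mu> *\<^sub>R f \<mu>" if "\<mu> \<in> eigenvalues M" for \<mu>
    using that unfolding f_def eigenvalues_def by (metis (mono_tags, lifting) mem_Collect_eq someI_ex)
  have orth: "f \<mu> \<bullet> f \<nu> = 0" if "\<mu> \<in> eigenvalues M" "\<nu> \<in> eigenvalues M" "\<mu> \<noteq> \<nu>" for \<mu> \<nu>
  proof -
    have "f \<mu> \<bullet> (M *v f \<nu>) = (M *v f \<mu>) \<bullet> f \<nu>"
      by (metis dot_lmul_matrix sym transpose_matrix_vector)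
    then have "\<nu> * (f \<mu> \<bullet> f \<nu>) = \<mu> * (f \<mu> \<bullet> f \<nu>)"
      using f that by simp
    then show ?thesis
      using that by simp
  qed
  have "inj_on f (eigenvalues M)"
    by (rule inj_onI) (metis f inner_eq_zero_iff orth)
  moreover have "independent (f ` eigenvalues M)"
    by (rule pairwise_orthogonal_independent)
      (use f orth in \<open>auto simp: pairwise_def orthogonal_def\<close>)
  then have "finite (f ` eigenvalues M)"
    by (rule independent_imp_finite)
  ultimately show ?thesis
    using finite_imageD by blast
qed

text \<open>Minimising the form of \<open>- M\<close> over the whole space yields an eigenvalue of
  \<open>M\<close> that bounds the quotient from above.\<close>

lemma Rayleigh_le_lambda_max:
  fixes M :: "real^'n^'n"
  assumes sym: "transpose M = M"
  shows "x \<bullet> (M *v x) \<le> lambda_max M * (norm x)\<^sup>2"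
proof -
  have neg: "transpose (- M) = - M"
    using sym by (simp add: transpose_def vec_eq_iff)
  have mv: "(- M) *v x = - (M *v x)" for x
    by (simp add: matrix_vector_mult_def vec_eq_iff sum_negf)
  have "(UNIV :: (real^'n) set) \<noteq> {0}"
    by (metis UNIV_I axis_eq_0_iff singletonD zero_neq_one)
  then obtain v \<mu> where v: "v \<noteq> 0" "(- M) *v v = \<mu> *\<^sub>R v"
    and le: "\<And>x. \<mu> * (norm x)\<^sup>2 \<le> x \<bullet> ((- M) *v x)"
    using eigenvector_of_Rayleigh_minimum[OF neg subspace_UNIV] by auto
  have "M *v v = (- \<mu>) *\<^sub>R v"
    using v(2) mv[of v] by (metis minus_equation_iff scaleR_minus_left)
  then have "- \<mu> \<in> eigenvalues M"
    using v(1) by (auto simp: eigenvalues_def)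
  then have "- \<mu> \<le> lambda_max M"
    unfolding lambda_max_def by (intro Max_ge finite_eigenvalues_symmetric sym)
  then have "- \<mu> * (norm x)\<^sup>2 \<le> lambda_max M * (norm x)\<^sup>2"
    by (rule mult_right_mono) simp
  with le[of x] show ?thesis
    by (simp add: mv)
qed

section \<open>The Gram matrix and the smallest nonzero singular value\<close>

lemma inner_gram: "x \<bullet> ((transpose A ** A) *v y) = (A *v x) \<bullet> (A *v y)"
  for A :: "real^'n^'m"
  by (metis dot_lmul_matrix inner_commute matrix_vector_mul_assoc transpose_matrix_vector)

lemma transpose_mult_eq_0D:
  fixes A :: "real^'n^'m"
  assumes "A *v (transpose A *v y) = 0"
  shows "transpose A *v y = 0"
proof -
  have "(transpose A *v y) \<bullet> (transpose A *v y) = y \<bullet> (A *v (transpose A *v y))"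
    by (metis dot_lmul_matrix transpose_matrix_vector)
  with assms show ?thesis
    by simp
qed

lemma transpose_mult_nontrivial:
  fixes A :: "real^'n^'m"
  assumes "A \<noteq> 0"
  obtains y where "transpose A *v y \<noteq> 0"
proof -
  have "transpose A \<noteq> 0"
    using assms by (auto simp: transpose_def vec_eq_iff)
  then show thesis
    using that by (auto simp: matrix_eq)
qed

text \<open>The Rayleigh minimum \<mu> of the Gram matrix on the range of \<open>transpose A\<close>
  is an eigenvalue. It is nonzero because the kernel of \<open>A\<close> meets that range only in 0,
  so its root competes in the minimum defining \<open>sigma_min\<close>.\<close>

lemma sigma_min_bound:
  fixes A :: "real^'n^'m"
  assumes "A \<noteq> 0"
  shows "sigma_min A > 0"
    and "(sigma_min A)\<^sup>2 * (norm (transpose A *v y))\<^sup>2 \<le> (norm (A *v (transpose A *v y)))\<^sup>2"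
proof -
  let ?M = "transpose A ** A" and ?V = "range ((*v) (transpose A))"
  have sym: "transpose ?M = ?M"
    by (simp add: matrix_transpose_mul)
  have V: "subspace ?V"
    using linear_subspace_image[OF matrix_vector_mul_linear subspace_UNIV] .
  have inv: "?M *v x \<in> ?V" for x
    by (metis matrix_vector_mul_assoc rangeI)
  have "?V \<noteq> {0}"
    using transpose_mult_nontrivial[OF assms] by (metis rangeI singletonD)
  then obtain v \<mu> where v: "v \<in> ?V" "v \<noteq> 0" "?M *v v = \<mu> *\<^sub>R v"
    and le: "\<And>x. x \<in> ?V \<Longrightarrow> \<mu> * (norm x)\<^sup>2 \<le> x \<bullet> (?M *v x)"
    using eigenvector_of_Rayleigh_minimum[OF sym V _ inv] by blast
  have nonneg: "0 \<le> \<nu>" if "\<nu> \<in> eigenvalues ?M" for \<nu>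
  proof -
    obtain u where u: "u \<noteq> 0" "?M *v u = \<nu> *\<^sub>R u"
      using \<open>\<nu> \<in> eigenvalues ?M\<close> by (auto simp: eigenvalues_def)
    have "\<nu> * (u \<bullet> u) = (A *v u) \<bullet> (A *v u)"
      using u(2) inner_gram[of u A u] by simp
    then show ?thesis
      using u(1) by (metis inner_ge_zero inner_gt_zero_iff zero_le_mult_iff not_less)
  qed
  have ev: "\<mu> \<in> eigenvalues ?M"
    using v by (auto simp: eigenvalues_def)
  have "\<mu> \<noteq> 0"
  proof
    assume "\<mu> = 0"
    then have "A *v v = 0"
      using v(3) inner_gram[of v A v] by simp
    then show False
      using v(1,2) transpose_mult_eq_0D[of A] by auto
  qed
  let ?S = "singular_values A - {0}"
  have fin: "finite ?S"
    using finite_eigenvalues_symmetric[OF sym] by (simp add: singular_values_def)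
  have mem: "sqrt \<mu> \<in> ?S"
    using ev \<open>\<mu> \<noteq> 0\<close> by (simp add: singular_values_def)
  have "sigma_min A \<in> ?S"
    unfolding sigma_min_def using fin mem by (intro Min_in) auto
  then show pos: "sigma_min A > 0"
    using nonneg by (force simp: singular_values_def)
  have "sigma_min A \<le> sqrt \<mu>"
    unfolding sigma_min_def by (intro Min_le fin mem)
  then have "(sigma_min A)\<^sup>2 \<le> (sqrt \<mu>)\<^sup>2"
    using pos by (intro power_mono) auto
  also have "(sqrt \<mu>)\<^sup>2 = \<mu>"
    using nonneg[OF ev] by simp
  finally have "(sigma_min A)\<^sup>2 * (norm (transpose A *v y))\<^sup>2 \<le> \<mu> * (norm (transpose A *v y))\<^sup>2"
    by (rule mult_right_mono) simp
  also have "\<dots> \<le> (transpose A *v y) \<bullet> (?M *v (transpose A *v y))"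
    by (rule le) simp
  also have "\<dots> = (norm (A *v (transpose A *v y)))\<^sup>2"
    by (simp only: inner_gram power2_norm_eq_inner)
  finally show "(sigma_min A)\<^sup>2 * (norm (transpose A *v y))\<^sup>2 \<le> (norm (A *v (transpose A *v y)))\<^sup>2" .
qed

section \<open>Existence and uniqueness of the Moore-Penrose pseudoinverse\<close>

text \<open>The symmetry conditions allow the factors to be swapped by transposing, which identifies
  both products with \<open>A\<close>; then
  \<open>X = X ** A ** X = Y ** A ** Y = Y\<close>.\<close>

lemma is_pseudoinverse_unique:
  assumes "is_pseudoinverse A X" "is_pseudoinverse A Y"
  shows "X = Y"
proof -
  have X: "A ** X ** A = A" "X ** A ** X = X" "transpose (A ** X) = A ** X" "transpose (X ** A) = X ** A"
    and Y: "A ** Y ** A = A" "Y ** A ** Y = Y" "transpose (A ** Y) = A ** Y" "transpose (Y ** A) = Y ** A"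
    using assms by (auto simp: is_pseudoinverse_def)
  have AX: "A ** X = A ** Y"
  proof -
    have "A ** X = (A ** Y) ** (A ** X)"
      by (metis Y(1) matrix_mul_assoc)
    also have "\<dots> = transpose ((A ** X) ** (A ** Y))"
      by (metis X(3) Y(3) matrix_transpose_mul)
    also have "\<dots> = A ** Y"
      by (metis X(1) Y(3) matrix_mul_assoc)
    finally show ?thesis .
  qed
  have XA: "X ** A = Y ** A"
  proof -
    have "X ** A = (X ** A) ** (Y ** A)"
      by (metis Y(1) matrix_mul_assoc)
    also have "\<dots> = transpose ((Y ** A) ** (X ** A))"
      by (metis X(4) Y(4) matrix_transpose_mul)
    also have "\<dots> = Y ** A"
      by (metis X(1) Y(4) matrix_mul_assoc)
    finally show ?thesis .
  qed
  show ?thesis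
    by (metis AX XA X(2) Y(2) matrix_mul_assoc)
qed

lemma orthogonal_projection_matrix:
  fixes V :: "(real^'n) set"
  assumes "subspace V"
  obtains Q :: "real^'n^'n" where "transpose Q = Q" "\<And>x. Q *v x \<in> V" "\<And>x. x \<in> V \<Longrightarrow> Q *v x = x"
proof -
  obtain B where B: "B \<subseteq> V" "pairwise orthogonal B" "\<And>x. x \<in> B \<Longrightarrow> norm x = 1"
    "independent B" "span B = V"
    using orthonormal_basis_subspace[OF assms] by metis
  have fin: "finite B"
    using B(4) independent_imp_finite by blast
  define f where "f x = (\<Sum>b\<in>B. (b \<bullet> x) *\<^sub>R b)" for x
  have lin: "linear f"
    unfolding f_def by (rule linearI)
      (auto simp: inner_add_right scaleR_add_left sum.distrib scaleR_sum_right)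
  have mv: "matrix f *v x = f x" for x
    using lin by simp
  have sym: "(matrix f *v x) \<bullet> y = x \<bullet> (matrix f *v y)" for x y
    by (simp add: mv f_def inner_sum_left inner_sum_right inner_commute mult.commute)
  have "transpose (matrix f) = matrix f"
    by (metis adjoint_matrix adjoint_unique matrix_of_matrix_vector_mul sym)
  moreover have "matrix f *v x \<in> V" for x
    unfolding mv f_def B(5)[symmetric] by (intro span_sum span_scale span_base)
  moreover have "matrix f *v x = x" if "x \<in> V" for x
    unfolding mv f_def
    using orthonormal_basis_expand[OF B(2,3) _ fin, of x] that B(5) by (simp add: inner_commute)
  ultimately show thesis
    using that by blast
qed

lemma matrix_mult_add_rdistrib: "(A + B) ** C = A ** C + B ** C"
  for A B :: "'a::semiring_1^'n^'m"
  by (simp add: matrix_matrix_mult_def vec_eq_iff distrib_right sum.distrib)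

text \<open>With \<open>Q\<close> the orthogonal projection onto the kernel of \<open>A\<close>, the
  matrix \<open>transpose A ** A + Q\<close> is invertible: it acts as the Gram matrix on the
  orthogonal complement of the kernel and as the identity on the kernel. Its inverse times
  \<open>transpose A\<close> satisfies the four Penrose equations.\<close>

lemma is_pseudoinverse_exists:
  fixes A :: "real^'n^'m"
  shows "\<exists>X. is_pseudoinverse A X"
proof -
  let ?T = "transpose A"
  have "subspace {x. A *v x = 0}"
    by (auto simp: subspace_def matrix_vector_right_distrib matrix_vector_mult_scaleR)
  then obtain Q :: "real^'n^'n" where Qt: "transpose Q = Q" and "\<And>x. Q *v x \<in> {x. A *v x = 0}"
    and Qx: "\<And>x. x \<in> {x. A *v x = 0} \<Longrightarrow> Q *v x = x"
    by (rule orthogonal_projection_matrix) blast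
  then have AQ: "A ** Q = 0" and QQ: "Q ** Q = Q"
    by (auto simp: matrix_eq matrix_vector_mul_assoc[symmetric])
  have "transpose (A ** Q) = 0"
    by (simp add: AQ transpose_def vec_eq_iff)
  then have QT: "Q ** ?T = 0"
    by (simp add: matrix_transpose_mul Qt)
  define N where "N = ?T ** A + Q"
  have NQ: "N ** Q = Q"
    by (simp add: N_def matrix_mult_add_rdistrib QQ AQ flip: matrix_mul_assoc)
  have QN: "Q ** N = Q"
    by (simp add: N_def matrix_add_ldistrib QQ QT matrix_mul_assoc)
  \<comment> \<open>Applying \<open>Q\<close> isolates the kernel component, which must vanish; what
    remains is a vector in the kernel of the Gram matrix, hence of \<open>A\<close>, and
    \<open>Q\<close> fixes it.\<close>
  have "x = 0" if "N *v x = 0" for x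
  proof -
    have "Q *v x = 0"
      by (metis QN matrix_vector_mul_assoc matrix_vector_mult_0_right that)
    moreover from this have "(?T ** A) *v x = 0"
      using that by (simp add: N_def matrix_vector_mult_add_rdistrib)
    then have "A *v x = 0"
      using inner_gram[of x A x] by simp
    ultimately show ?thesis
      using Qx[of x] by simp
  qed
  then obtain N' where N': "N' ** N = mat 1"
    using matrix_left_invertible_ker[of N] by blast
  then have NN': "N ** N' = mat 1"
    using matrix_left_right_inverse by blast
  have "transpose (?T ** A + Q) = transpose (?T ** A) + transpose Q"
    unfolding transpose_def by (simp add: vec_eq_iff)
  then have Nt: "transpose N = N"
    by (simp add: N_def Qt matrix_transpose_mul)
  have "transpose N' ** N = transpose (N ** N')"
    by (simp add: matrix_transpose_mul Nt)
  then have "transpose N' ** N = mat 1"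
    by (simp add: NN')
  then have N't: "transpose N' = N'"
    by (metis NN' matrix_mul_assoc matrix_mul_lid matrix_mul_rid)
  have N'Q: "N' ** Q = Q"
    by (metis N' NQ matrix_mul_assoc matrix_mul_lid)
  have QN': "Q ** N' = Q"
    by (metis NN' QN matrix_mul_assoc matrix_mul_rid)
  define X where "X = N' ** ?T"
  have XA: "X ** A = mat 1 - Q"
  proof -
    have "X ** A + N' ** Q = mat 1"
      by (metis N' N_def X_def matrix_add_ldistrib matrix_mul_assoc)
    then show ?thesis
      using N'Q by (simp add: eq_diff_eq)
  qed
  have dl: "(mat 1 - Q) ** B = B - Q ** B" for B :: "real^'m^'n"
    using matrix_mult_add_rdistrib[of "mat 1 - Q" Q B] by (simp add: eq_diff_eq)
  have dr: "A ** (mat 1 - Q) = A - A ** Q"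
    using matrix_add_ldistrib[of A "mat 1 - Q" Q] by (simp add: eq_diff_eq)
  have diff_t: "transpose (mat 1 - Q) = transpose (mat 1) - transpose Q"
    unfolding transpose_def by (simp add: vec_eq_iff)
  have QX: "Q ** X = 0"
    by (simp add: X_def matrix_mul_assoc QN' QT)
  have "A ** X ** A = A"
    by (simp add: XA dr AQ flip: matrix_mul_assoc)
  moreover have "X ** A ** X = X"
    by (simp add: XA dl QX)
  moreover have "transpose (A ** X) = A ** X"
    by (simp add: X_def matrix_transpose_mul N't matrix_mul_assoc)
  moreover have "transpose (X ** A) = X ** A"
    by (simp add: XA Qt diff_t)
  ultimately show ?thesis
    unfolding is_pseudoinverse_def by blast
qed

lemma is_pseudoinverse_pseudoinverse: "is_pseudoinverse A (pseudoinverse A)"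
  unfolding pseudoinverse_def
  using is_pseudoinverse_exists is_pseudoinverse_unique by (metis theI')

section \<open>The form of the sampled matrix and the deterministic one-step estimate\<close>

text \<open>As a simplification rule it turns \<open>transpose A *v x\<close> into
  \<open>x v* A\<close>; from here on the first shape is kept.\<close>

declare transpose_matrix_vector [simp del]

lemma transpose_mult_transpose: "transpose (mult_transpose S) = mult_transpose S"
  by (simp add: transpose_def mult_transpose_def mult.commute)

text \<open>The right-hand side is the Euclidean inner product of the images of \<open>x\<close> and
  \<open>y\<close> under the transpose of \<open>S\<close>, so positivity and Cauchy-Schwarz for
  this form come from those of finite sums.\<close>

lemma inner_mult_transpose:
  "x \<bullet> (mult_transpose S *v y) = (\<Sum>l<length S. (x \<bullet> S ! l) * (y \<bullet> S ! l))"
proof -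
  have "(mult_transpose S *v y) $ i = (\<Sum>l<length S. S ! l $ i * (y \<bullet> S ! l))" for i
  proof -
    have "(mult_transpose S *v y) $ i = (\<Sum>j\<in>UNIV. \<Sum>l<length S. S ! l $ i * S ! l $ j * y $ j)"
      by (simp add: matrix_vector_mult_def mult_transpose_def sum_distrib_right)
    also have "\<dots> = (\<Sum>l<length S. \<Sum>j\<in>UNIV. S ! l $ i * S ! l $ j * y $ j)"
      by (rule sum.swap)
    finally show ?thesis
      by (simp add: inner_vec_def sum_distrib_left mult_ac)
  qed
  then have "x \<bullet> (mult_transpose S *v y) = (\<Sum>i\<in>UNIV. \<Sum>l<length S. x $ i * S ! l $ i * (y \<bullet> S ! l))"
    by (simp add: inner_vec_def[of x "mult_transpose S *v y"] sum_distrib_left mult_ac)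
  also have "\<dots> = (\<Sum>l<length S. \<Sum>i\<in>UNIV. x $ i * S ! l $ i * (y \<bullet> S ! l))"
    by (rule sum.swap)
  also have "\<dots> = (\<Sum>l<length S. (x \<bullet> S ! l) * (y \<bullet> S ! l))"
    by (simp add: inner_vec_def[of x] sum_distrib_right)
  finally show ?thesis .
qed

lemma mult_transpose_nonneg: "0 \<le> x \<bullet> (mult_transpose S *v x)"
  by (simp add: inner_mult_transpose sum_nonneg)

lemma mult_transpose_Cauchy_Schwarz:
  "(x \<bullet> (mult_transpose S *v y))\<^sup>2
    \<le> (x \<bullet> (mult_transpose S *v x)) * (y \<bullet> (mult_transpose S *v y))"
  using Cauchy_Schwarz_ineq_sum[of "\<lambda>l. x \<bullet> S ! l" "\<lambda>l. y \<bullet> S ! l" "{..<length S}"]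
  by (simp add: inner_mult_transpose power2_eq_square)

lemma inner_transpose_mult: "x \<bullet> (transpose A *v y) = (A *v x) \<bullet> y"
  for A :: "real^'n^'m"
  by (metis dot_lmul_matrix inner_commute transpose_matrix_vector)

lemma Rayleigh_gram_le_lambda_max:
  fixes A :: "real^'n^'m"
  shows "(A *v x) \<bullet> (mult_transpose S *v (A *v x))
    \<le> lambda_max (transpose A ** mult_transpose S ** A) * (norm x)\<^sup>2"
proof -
  have "transpose (transpose A ** mult_transpose S ** A) = transpose A ** mult_transpose S ** A"
    by (simp add: matrix_transpose_mul transpose_mult_transpose matrix_mul_assoc)
  from Rayleigh_le_lambda_max[OF this, of x] show ?thesis
    by (simp add: inner_transpose_mult flip: matrix_vector_mul_assoc)
qed

text \<open>
  Cauchy--Schwarz for the form of \<open>S S\<^sup>T\<close> against \<open>A A\<^sup>T S S\<^sup>T y\<close>, then cancelling one factor.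
\<close>

lemma norm_transpose_mult_transpose_le:
  fixes A :: "real^'n^'m"
  assumes L: "\<And>x. (A *v x) \<bullet> (mult_transpose S *v (A *v x)) \<le> L * (norm x)\<^sup>2"
  shows "(norm (transpose A *v (mult_transpose S *v y)))\<^sup>2 \<le> L * (y \<bullet> (mult_transpose S *v y))"
proof -
  define u where "u = transpose A *v (mult_transpose S *v y)"
  let ?q = "y \<bullet> (mult_transpose S *v y)"
  have "u \<bullet> u = (A *v u) \<bullet> (mult_transpose S *v y)"
    using inner_transpose_mult[of u A "mult_transpose S *v y"] by (simp add: u_def)
  then have "(u \<bullet> u)\<^sup>2 \<le> ((A *v u) \<bullet> (mult_transpose S *v (A *v u))) * ?q"
    using mult_transpose_Cauchy_Schwarz by metis
  also have "\<dots> \<le> (L * (norm u)\<^sup>2) * ?q"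
    by (intro mult_right_mono L mult_transpose_nonneg)
  finally have le: "(norm u)\<^sup>2 * (norm u)\<^sup>2 \<le> (norm u)\<^sup>2 * (L * ?q)"
    unfolding power2_norm_eq_inner by (simp add: power2_eq_square mult_ac)
  \<comment> \<open>Any unit vector shows that \<open>L\<close> is nonnegative, which settles the
    case \<open>u = 0\<close>, where nothing can be cancelled.\<close>
  have "0 \<le> (A *v axis undefined 1) \<bullet> (mult_transpose S *v (A *v axis undefined 1))"
    by (rule mult_transpose_nonneg)
  also have "\<dots> \<le> L"
    using L[of "axis undefined 1"] by simp
  finally have "0 \<le> L * ?q"
    by (simp add: mult_transpose_nonneg)
  show ?thesis
  proof (cases "u = 0")
    case True
    with \<open>0 \<le> L * ?q\<close> show ?thesis
      by (simp add: u_def)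
  next
    case False
    with le show ?thesis
      by (simp only: mult_le_cancel_left_pos zero_less_power zero_less_norm_iff not_False_eq_True flip: u_def)
  qed
qed

text \<open>The estimate is pointwise in \<open>S\<close>. The linear cross term in \<open>r\<close>
  is kept exactly, since it vanishes only after taking expectations; only the product of
  \<open>g\<close> and \<open>h\<close> is estimated.\<close>

lemma BRSI_step_norm_le:
  fixes A :: "real^'n^'m"
  assumes L: "\<And>x. (A *v x) \<bullet> (mult_transpose S *v (A *v x)) \<le> L * (norm x)\<^sup>2"
    and "\<epsilon> > 0"
  shows "(norm (e - \<alpha> *\<^sub>R (transpose A *v (mult_transpose S *v (A *v e + r)))))\<^sup>2
    \<le> (norm e)\<^sup>2 - \<alpha> * (2 - \<alpha> * (1 + \<epsilon>) * L) * ((A *v e) \<bullet> (mult_transpose S *v (A *v e)))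
      - 2 * \<alpha> * ((A *v e) \<bullet> (mult_transpose S *v r))
      + \<alpha>\<^sup>2 * (1 + 1 / \<epsilon>) * (norm (transpose A *v (mult_transpose S *v r)))\<^sup>2"
proof -
  define g h q where "g = transpose A *v (mult_transpose S *v (A *v e))"
    and "h = transpose A *v (mult_transpose S *v r)"
    and "q = (A *v e) \<bullet> (mult_transpose S *v (A *v e))"
  have g: "(norm g)\<^sup>2 \<le> L * q"
    unfolding g_def q_def by (rule norm_transpose_mult_transpose_le[OF L])
  have eg: "e \<bullet> g = q" and eh: "e \<bullet> h = (A *v e) \<bullet> (mult_transpose S *v r)"
    by (simp_all add: g_def h_def q_def inner_transpose_mult)
  \<comment> \<open>Expanding this square and dividing by \<epsilon> is Young's inequality with
    weight \<epsilon>.\<close>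
  have "0 \<le> (norm (\<epsilon> *\<^sub>R g - h))\<^sup>2"
    by simp
  also have "\<dots> = \<epsilon> * (\<epsilon> * (norm g)\<^sup>2 - 2 * (g \<bullet> h)) + (norm h)\<^sup>2"
    unfolding power2_norm_eq_inner
    by (simp add: inner_diff_left inner_diff_right inner_commute algebra_simps)
  finally have "2 * (g \<bullet> h) \<le> \<epsilon> * (norm g)\<^sup>2 + (norm h)\<^sup>2 / \<epsilon>"
    using \<open>\<epsilon> > 0\<close> by (simp add: field_simps)
  then have gh: "(norm (g + h))\<^sup>2 \<le> (1 + \<epsilon>) * (norm g)\<^sup>2 + (1 + 1 / \<epsilon>) * (norm h)\<^sup>2"
    unfolding power2_norm_eq_inner
    by (simp add: inner_add_left inner_add_right inner_commute algebra_simps)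
  also have "\<dots> \<le> (1 + \<epsilon>) * (L * q) + (1 + 1 / \<epsilon>) * (norm h)\<^sup>2"
    using g \<open>\<epsilon> > 0\<close> by (intro add_mono mult_left_mono) auto
  finally have "\<alpha>\<^sup>2 * (norm (g + h))\<^sup>2 \<le> \<alpha>\<^sup>2 * ((1 + \<epsilon>) * (L * q) + (1 + 1 / \<epsilon>) * (norm h)\<^sup>2)"
    by (rule mult_left_mono) simp
  moreover have "(norm (e - \<alpha> *\<^sub>R (g + h)))\<^sup>2
      = (norm e)\<^sup>2 - 2 * \<alpha> * (e \<bullet> g) - 2 * \<alpha> * (e \<bullet> h) + \<alpha>\<^sup>2 * (norm (g + h))\<^sup>2"
    unfolding power2_norm_eq_inner
    by (simp add: inner_diff_left inner_diff_right inner_add_right inner_add_left inner_commute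
        algebra_simps power2_eq_square)
  ultimately have "(norm (e - \<alpha> *\<^sub>R (g + h)))\<^sup>2 \<le> (norm e)\<^sup>2 - \<alpha> * (2 - \<alpha> * (1 + \<epsilon>) * L) * q
      - 2 * \<alpha> * (e \<bullet> h) + \<alpha>\<^sup>2 * (1 + 1 / \<epsilon>) * (norm h)\<^sup>2"
    unfolding eg by (simp add: algebra_simps power2_eq_square)
  then show ?thesis
    unfolding eh unfolding g_def h_def q_def by (simp add: matrix_vector_right_distrib)
qed

section \<open>The error recursion on the range of the transpose\<close>

lemma pseudoinverse_in_range_transpose: "pseudoinverse A *v b \<in> range ((*v) (transpose A))"
proof -
  let ?X = "pseudoinverse A"
  have "?X = transpose (?X ** A) ** ?X"
    using is_pseudoinverse_pseudoinverse[of A] by (simp add: is_pseudoinverse_def)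
  then have "?X = transpose A ** (transpose ?X ** ?X)"
    by (simp add: matrix_transpose_mul matrix_mul_assoc)
  then show ?thesis
    by (metis matrix_vector_mul_assoc rangeI)
qed

text \<open>These are the normal equations, obtained by transposing \<open>A ** X ** A = A\<close>
  and using the symmetry of \<open>A ** X\<close>.\<close>

lemma transpose_residual_eq_0:
  "transpose A *v (A *v (pseudoinverse A *v b) - b) = 0"
proof -
  let ?X = "pseudoinverse A"
  have "transpose A ** (A ** ?X) = transpose (A ** ?X ** A)"
    using is_pseudoinverse_pseudoinverse[of A] unfolding is_pseudoinverse_def
    by (metis matrix_transpose_mul)
  also have "\<dots> = transpose A"
    using is_pseudoinverse_pseudoinverse[of A] by (simp add: is_pseudoinverse_def)
  finally show ?thesis
    by (simp add: matrix_vector_mult_diff_distrib matrix_vector_mul_assoc)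
qed

lemma mult_x_star: "A *v x_star A b x0 = A *v (pseudoinverse A *v b)"
proof -
  have "A *v (pseudoinverse A *v (A *v x0)) = A *v x0"
    using is_pseudoinverse_pseudoinverse[of A]
    by (simp add: is_pseudoinverse_def matrix_vector_mul_assoc matrix_mul_assoc)
  then show ?thesis
    by (simp add: x_star_def matrix_vector_right_distrib matrix_vector_mult_diff_distrib
        matrix_vector_mult_diff_rdistrib flip: matrix_vector_mul_assoc)
qed

lemma subspace_range_transpose: "subspace (range ((*v) (transpose A)))"
  for A :: "real^'n^'m"
  using linear_subspace_image[OF matrix_vector_mul_linear subspace_UNIV] .

text \<open>\<open>x_star\<close> and \<open>pseudoinverse A *v b\<close> have the same image under
  \<open>A\<close>, so the residual of an iterate is the image of its error plus a fixed
  vector.\<close>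

lemma brsi_error_Suc:
  "brsi A b \<alpha> x0 S (Suc k) - x_star A b x0 =
    (brsi A b \<alpha> x0 S k - x_star A b x0) - \<alpha> *\<^sub>R (transpose A *v (mult_transpose (S k) *v
      (A *v (brsi A b \<alpha> x0 S k - x_star A b x0) + (A *v (pseudoinverse A *v b) - b))))"
  by (simp add: matrix_vector_mult_diff_distrib mult_x_star flip: matrix_vector_mul_assoc)

text \<open>\<open>x_star\<close> contains the kernel component of \<open>x0\<close>, so the initial
  error is \<open>pseudoinverse A *v (A *v x0 - b)\<close>; every step then subtracts a vector of
  the range.\<close>

lemma brsi_error_in_range_transpose:
  "brsi A b \<alpha> x0 S k - x_star A b x0 \<in> range ((*v) (transpose A))"
proof (induction k)
  case 0
  have "brsi A b \<alpha> x0 S 0 - x_star A b x0 = pseudoinverse A *v (A *v x0 - b)"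
    by (simp add: x_star_def matrix_vector_mult_diff_distrib matrix_vector_mult_diff_rdistrib
        flip: matrix_vector_mul_assoc)
  then show ?case
    using pseudoinverse_in_range_transpose by metis
next
  case (Suc k)
  then show ?case
    unfolding brsi_error_Suc
    by (rule subspace_diff[OF subspace_range_transpose])
      (rule subspace_scale[OF subspace_range_transpose], rule rangeI)
qed

text \<open>Iterate \<open>k\<close> uses the samples 0 to \<open>k - 1\<close> only, so it can be
  treated as a function of finitely many samples that are independent of sample
  \<open>k\<close>.\<close>

lemma brsi_cong:
  assumes "\<And>j. j < k \<Longrightarrow> s j = t j"
  shows "brsi A b \<alpha> x0 s k = brsi A b \<alpha> x0 t k"
  using assms by (induction k) auto

section \<open>Almost every sample is a realization\<close>

lemma sets_colmat_ball:
  fixes T :: "'m::finite colmat"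
  shows "colmat_ball T e \<in> sets colmat_borel"
proof -
  let ?pad = "\<lambda>(S :: 'm colmat) l. if l < length S then S ! l else 0"
  let ?M = "count_space UNIV \<Otimes>\<^sub>M (\<Pi>\<^sub>M l\<in>(UNIV :: nat set). (borel :: (real^'m) measure))"
  have f: "(\<lambda>S. (length S, ?pad S)) \<in> measurable colmat_borel ?M"
    unfolding colmat_borel_def by (rule measurable_vimage_algebra1) (auto simp: space_pair_measure space_PiM)
  have len [measurable]: "(length :: 'm colmat \<Rightarrow> nat) \<in> measurable colmat_borel (count_space UNIV)"
    using measurable_compose[OF f measurable_fst] by simp
  have pad [measurable]: "(\<lambda>S. ?pad S l) \<in> borel_measurable colmat_borel" for l
    using measurable_compose[OF measurable_compose[OF f measurable_snd] measurable_component_singleton[of l]]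
    by simp
  \<comment> \<open>Once the lengths agree, the padding is invisible for the indices in question,
    and the padded columns are measurable on the whole space.\<close>
  have "colmat_ball T e = {S \<in> space colmat_borel.
      length S = length T \<and> (\<forall>l<length T. dist (?pad S l) (T ! l) < e)}"
    by (auto simp: colmat_ball_def colmat_borel_def)
  also have "\<dots> \<in> sets colmat_borel"
    by measurable
  finally show ?thesis .
qed

text \<open>The complement of the support is covered by countably many null balls: the centres have
  columns in a countable dense set and the radii are \<open>1 / Suc n\<close>.\<close>

lemma AE_realizations:
  assumes D: "prob_space D" "sets D = sets colmat_borel"
  shows "AE S in D. S \<in> realizations D"
proof -
  interpret prob_space D by fact
  obtain C :: "(real^'a) set" where C: "countable C" "\<And>X. open X \<Longrightarrow> X \<noteq> {} \<Longrightarrow> \<exists>d\<in>C. d \<in> X"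
    by (rule countable_dense_setE) blast
  define X where "X = {(T, n :: nat) \<in> lists C \<times> UNIV. measure D (colmat_ball T (1 / Suc n)) = 0}"
  have "countable X"
    unfolding X_def using C(1) by (intro countable_subset[OF _ countable_SIGMA[of "lists C"]]) auto
  moreover have "AE S in D. S \<notin> colmat_ball (fst p) (1 / Suc (snd p))" if "p \<in> X" for p
  proof -
    have "colmat_ball (fst p) (1 / Suc (snd p)) \<in> null_sets D"
      using that by (auto simp: X_def null_sets_def emeasure_eq_measure D(2) sets_colmat_ball)
    then show ?thesis
      by (rule AE_not_in)
  qed
  ultimately have "AE S in D. \<forall>p\<in>X. S \<notin> colmat_ball (fst p) (1 / Suc (snd p))"
    by (simp add: AE_ball_countable)
  then show ?thesis
  proof eventually_elim
    fix S :: "'a colmat"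
    assume S: "\<forall>p\<in>X. S \<notin> colmat_ball (fst p) (1 / Suc (snd p))"
    show "S \<in> realizations D"
    proof (rule ccontr)
      assume "S \<notin> realizations D"
      then obtain e where e: "e > 0" "measure D (colmat_ball S e) = 0"
        by (auto simp: realizations_def not_less measure_le_0_iff)
      \<comment> \<open>Half of \<open>e\<close> is enough: a ball of this radius that contains
        \<open>S\<close> then lies inside the null ball of radius \<open>e\<close> around
        \<open>S\<close>.\<close>
      obtain n :: nat where n: "1 / Suc n < e / 2"
        using nat_approx_posE[of "e / 2"] e(1) by auto
      have "\<exists>c\<in>C. dist (S ! l) c < 1 / Suc n" for l
        using C(2)[of "ball (S ! l) (1 / Suc n)"] by auto
      then obtain c where c: "\<And>l. c l \<in> C" "\<And>l. dist (S ! l) (c l) < 1 / Suc n"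
        by metis
      define T where "T = map c [0..<length S]"
      have "S \<in> colmat_ball T (1 / Suc n)"
        using c(2) by (simp add: colmat_ball_def T_def)
      moreover have "colmat_ball T (1 / Suc n) \<subseteq> colmat_ball S e"
      proof
        fix R assume R: "R \<in> colmat_ball T (1 / Suc n)"
        have "dist (R ! l) (S ! l) < e" if "l < length S" for l
        proof -
          have "dist (R ! l) (c l) < 1 / Suc n"
            using R that by (simp add: colmat_ball_def T_def)
          then show ?thesis
            using dist_triangle2[of "R ! l" "S ! l" "c l"] c(2)[of l] n by linarith
        qed
        then show "R \<in> colmat_ball S e"
          using R by (simp add: colmat_ball_def T_def)
      qed
      then have "measure D (colmat_ball T (1 / Suc n)) \<le> measure D (colmat_ball S e)"
        by (intro finite_measure_mono) (auto simp: D(2) sets_colmat_ball)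
      then have "measure D (colmat_ball T (1 / Suc n)) = 0"
        using e(2) measure_nonneg[of D "colmat_ball T (1 / Suc n)"] by linarith
      moreover have "T \<in> lists C"
        using c(1) by (auto simp: T_def)
      ultimately show False
        using S by (force simp: X_def)
    qed
  qed
qed

text \<open>Existence of the maximum makes \<open>GREATEST\<close> an upper bound. One null set
  serves all \<open>x\<close>, because the bound is later applied to vectors that depend on
  \<open>S\<close>.\<close>

lemma AE_Rayleigh_le_lambda_max_r:
  fixes A :: "real^'n^'m" and D :: "'m colmat measure"
  assumes D: "prob_space D" "sets D = sets colmat_borel"
    and max: "\<exists>y\<in>lambda_max_values D A. \<forall>z\<in>lambda_max_values D A. z \<le> y"
  shows "AE S in D. \<forall>x. (A *v x) \<bullet> (mult_transpose S *v (A *v x)) \<le> lambda_max_r D A * (norm x)\<^sup>2"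
  using AE_realizations[OF D]
proof eventually_elim
  fix S assume "S \<in> realizations D"
  then have "lambda_max (transpose A ** mult_transpose S ** A) \<in> lambda_max_values D A"
    by (auto simp: lambda_max_values_def)
  moreover from max obtain y where y: "y \<in> lambda_max_values D A" "\<And>z. z \<in> lambda_max_values D A \<Longrightarrow> z \<le> y"
    by blast
  then have "lambda_max_r D A = y"
    unfolding lambda_max_r_def by (intro Greatest_equality) auto
  ultimately have "lambda_max (transpose A ** mult_transpose S ** A) * (norm x)\<^sup>2 \<le> lambda_max_r D A * (norm x)\<^sup>2" for x :: "real^'n"
    using y by (intro mult_right_mono) auto
  then show "\<forall>x. (A *v x) \<bullet> (mult_transpose S *v (A *v x)) \<le> lambda_max_r D A * (norm x)\<^sup>2"
    using Rayleigh_gram_le_lambda_max order_trans by blast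
qed

section \<open>Expectations, measurability and independence\<close>

text \<open>The integrand is a bounded linear functional of the matrix, so the expectation passes
  through it.\<close>

lemma has_bochner_integral_inner_matrix_vector:
  fixes F :: "'a \<Rightarrow> real^'n^'m"
  assumes "has_bochner_integral M F B"
  shows "has_bochner_integral M (\<lambda>s. x \<bullet> (F s *v y)) (x \<bullet> (B *v y))"
proof -
  have "linear (\<lambda>H :: real^'n^'m. x \<bullet> (H *v y))"
    by (rule linearI)
      (simp_all add: matrix_vector_mult_add_rdistrib inner_add_right scaleR_matrix_vector_assoc[symmetric])
  then show ?thesis
    by (intro has_bochner_integral_bounded_linear[OF _ assms]) (simp add: linear_conv_bounded_linear)
qed

lemma borel_measurable_matrix_vector_mult [measurable (raw)]:
  fixes F :: "'a \<Rightarrow> real^'n^'m"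
  assumes "F \<in> borel_measurable M" "g \<in> borel_measurable M"
  shows "(\<lambda>s. F s *v g s) \<in> borel_measurable M"
  using assms
  by (rule borel_measurable_continuous_Pair)
    (auto simp: matrix_vector_mult_def intro!: continuous_intros continuous_on_vec_lambda)

text \<open>The index set is left open since two are used: all of \<open>UNIV\<close> for
  measurability on \<open>P\<close>, and \<open>{..<k}\<close> for separating the past from the next
  sample.\<close>

lemma measurable_brsi:
  assumes [measurable]: "mult_transpose \<in> borel_measurable D" and "{..<k} \<subseteq> J"
  shows "(\<lambda>s. brsi A b \<alpha> x0 s k) \<in> borel_measurable (Pi\<^sub>M J (\<lambda>_. D))"
  using assms(2)
proof (induction k)
  case (Suc k)
  have "{..<k} \<subseteq> J" and "k \<in> J"
    using Suc.prems by auto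
  then have [measurable]: "(\<lambda>s. brsi A b \<alpha> x0 s k) \<in> borel_measurable (Pi\<^sub>M J (\<lambda>_. D))"
    using Suc.IH by blast
  have [measurable]: "(\<lambda>s. s k) \<in> measurable (Pi\<^sub>M J (\<lambda>_. D)) D"
    using \<open>k \<in> J\<close> by (rule measurable_component_singleton)
  show ?case
    by (simp flip: matrix_vector_mul_assoc)
qed simp

text \<open>Independence makes the joint law a product, and Tonelli applies. Nonnegative integrals
  allow this before any moment of the iterates is known to be finite.\<close>

lemma (in prob_space) nn_integral_indep_var:
  assumes indep: "indep_var M1 X M2 Y" and f: "f \<in> borel_measurable (M1 \<Otimes>\<^sub>M M2)"
  shows "(\<integral>\<^sup>+\<omega>. f (X \<omega>, Y \<omega>) \<partial>M) = (\<integral>\<^sup>+\<omega>. \<integral>\<^sup>+y. f (X \<omega>, y) \<partial>distr M M2 Y \<partial>M)"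
proof -
  have X: "random_variable M1 X" and Y: "random_variable M2 Y"
    and eq: "distr M M1 X \<Otimes>\<^sub>M distr M M2 Y = distr M (M1 \<Otimes>\<^sub>M M2) (\<lambda>\<omega>. (X \<omega>, Y \<omega>))"
    using indep unfolding indep_var_distribution_eq by auto
  interpret Y: prob_space "distr M M2 Y"
    by (rule prob_space_distr[OF Y])
  have f': "f \<in> borel_measurable (M1 \<Otimes>\<^sub>M distr M M2 Y)"
    using f by (simp cong: measurable_cong_sets)
  have "(\<integral>\<^sup>+\<omega>. f (X \<omega>, Y \<omega>) \<partial>M) = integral\<^sup>N (distr M M1 X \<Otimes>\<^sub>M distr M M2 Y) f"
    unfolding eq using X Y f by (simp add: nn_integral_distr)
  also have "\<dots> = (\<integral>\<^sup>+x. \<integral>\<^sup>+y. f (x, y) \<partial>distr M M2 Y \<partial>distr M M1 X)"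
    using f by (intro Y.nn_integral_fst[symmetric]) (simp cong: measurable_cong_sets)
  also have "\<dots> = (\<integral>\<^sup>+\<omega>. \<integral>\<^sup>+y. f (X \<omega>, y) \<partial>distr M M2 Y \<partial>M)"
    using X Y.borel_measurable_nn_integral_fst[OF f'] by (intro nn_integral_distr) simp_all
  finally show ?thesis .
qed

text \<open>This replaces conditioning on the past: the samples before \<open>j\<close> are frozen
  and only sample \<open>j\<close> is averaged. Independence is available for families, so sample
  \<open>j\<close> first appears as a family over \<open>{j}\<close>.\<close>

lemma (in prob_space) nn_integral_indep_vars_lessThan:
  fixes X :: "nat \<Rightarrow> 'a \<Rightarrow> 'b"
  assumes indep: "indep_vars (\<lambda>_. N) X UNIV"
    and F: "F \<in> borel_measurable (Pi\<^sub>M {..<j} (\<lambda>_. N) \<Otimes>\<^sub>M N)"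
  shows "(\<integral>\<^sup>+\<omega>. F (restrict (\<lambda>i. X i \<omega>) {..<j}, X j \<omega>) \<partial>M)
    = (\<integral>\<^sup>+\<omega>. \<integral>\<^sup>+y. F (restrict (\<lambda>i. X i \<omega>) {..<j}, y) \<partial>distr M N (X j) \<partial>M)"
proof -
  let ?X = "\<lambda>I \<omega>. restrict (\<lambda>i. X i \<omega>) I" and ?N = "\<lambda>I. Pi\<^sub>M I (\<lambda>_. N)"
  have Xj [measurable]: "random_variable N (X j)"
    using indep by (auto simp: indep_vars_def)
  have ind: "indep_var (?N {..<j}) (?X {..<j}) (?N {j}) (?X {j})"
    using indep by (rule indep_var_restrict) auto
  have Y [measurable]: "random_variable (?N {j}) (?X {j})"
    using ind by (rule indep_var_rv2)
  have X [measurable]: "random_variable (?N {..<j}) (?X {..<j})"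
    using ind by (rule indep_var_rv1)
  have [measurable]: "(\<lambda>t. t j) \<in> measurable (?N {j}) N"
    by (rule measurable_component_singleton) simp
  note F [measurable]
  have "(\<integral>\<^sup>+\<omega>. F (?X {..<j} \<omega>, X j \<omega>) \<partial>M)
      = (\<integral>\<^sup>+\<omega>. (\<lambda>(s, t). F (s, t j)) (?X {..<j} \<omega>, ?X {j} \<omega>) \<partial>M)"
    by simp
  also have "\<dots> = (\<integral>\<^sup>+\<omega>. \<integral>\<^sup>+t. F (?X {..<j} \<omega>, t j) \<partial>distr M (?N {j}) (?X {j}) \<partial>M)"
    by (subst nn_integral_indep_var[OF ind]) auto
  also have "\<dots> = (\<integral>\<^sup>+\<omega>. \<integral>\<^sup>+y. F (?X {..<j} \<omega>, y) \<partial>distr M N (X j) \<partial>M)"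
  proof (rule nn_integral_cong)
    fix \<omega> assume "\<omega> \<in> space M"
    then have "?X {..<j} \<omega> \<in> space (?N {..<j})"
      by (rule measurable_space[OF X])
    then have Fm [measurable]: "(\<lambda>y. F (?X {..<j} \<omega>, y)) \<in> borel_measurable N"
      using F by (rule measurable_Pair2[rotated])
    have "(\<integral>\<^sup>+t. F (?X {..<j} \<omega>, t j) \<partial>distr M (?N {j}) (?X {j}))
        = (\<integral>\<^sup>+\<omega>'. F (?X {..<j} \<omega>, ?X {j} \<omega>' j) \<partial>M)"
      by (rule nn_integral_distr) (use Y in auto)
    also have "\<dots> = (\<integral>\<^sup>+y. F (?X {..<j} \<omega>, y) \<partial>distr M N (X j))"
      by (simp add: nn_integral_distr)
    finally show "(\<integral>\<^sup>+t. F (?X {..<j} \<omega>, t j) \<partial>distr M (?N {j}) (?X {j}))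
        = (\<integral>\<^sup>+y. F (?X {..<j} \<omega>, y) \<partial>distr M N (X j))" .
  qed
  finally show ?thesis .
qed

section \<open>Contraction in expectation and the final bound\<close>

text \<open>For \<open>v\<close> in the range of \<open>transpose A\<close>, the squared norm of
  \<open>A *v v\<close> is the expectation of a form that is almost surely at most \<open>L\<close>
  times the squared norm of \<open>v\<close>.\<close>

lemma sigma_min_power2_le_bound:
  fixes A :: "real^'n^'m" and D :: "'m colmat measure"
  assumes "A \<noteq> 0" "prob_space D" and hbi: "has_bochner_integral D mult_transpose (mat 1)"
    and L: "AE S in D. \<forall>x. (A *v x) \<bullet> (mult_transpose S *v (A *v x)) \<le> L * (norm x)\<^sup>2"
  shows "(sigma_min A)\<^sup>2 \<le> L"
proof -
  interpret prob_space D by fact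
  obtain y where y: "transpose A *v y \<noteq> 0"
    by (rule transpose_mult_nontrivial[OF \<open>A \<noteq> 0\<close>])
  define v where "v = transpose A *v y"
  have "has_bochner_integral D (\<lambda>S. (A *v v) \<bullet> (mult_transpose S *v (A *v v))) ((norm (A *v v))\<^sup>2)"
    using has_bochner_integral_inner_matrix_vector[OF hbi, of "A *v v" "A *v v"]
    by (simp add: power2_norm_eq_inner)
  moreover have "has_bochner_integral D (\<lambda>S. L * (norm v)\<^sup>2) (L * (norm v)\<^sup>2)"
    by (simp add: has_bochner_integral_iff prob_space)
  ultimately have "(norm (A *v v))\<^sup>2 \<le> L * (norm v)\<^sup>2"
    using L by (auto simp: has_bochner_integral_iff dest!: integral_mono_AE)
  moreover have "(sigma_min A)\<^sup>2 * (norm v)\<^sup>2 \<le> (norm (A *v v))\<^sup>2"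
    unfolding v_def by (rule sigma_min_bound[OF \<open>A \<noteq> 0\<close>])
  ultimately have "(sigma_min A)\<^sup>2 * (norm v)\<^sup>2 \<le> L * (norm v)\<^sup>2"
    by linarith
  then show ?thesis
    using y by (simp add: v_def)
qed

lemma nn_integral_BRSI_step_le:
  fixes A :: "real^'n^'m" and D :: "'m colmat measure" and r :: "real^'m"
  assumes "A \<noteq> 0" "prob_space D" and hbi: "has_bochner_integral D mult_transpose (mat 1)"
    and L: "AE S in D. \<forall>x. (A *v x) \<bullet> (mult_transpose S *v (A *v x)) \<le> L * (norm x)\<^sup>2"
    and "\<epsilon> > 0" "\<alpha> > 0" and \<alpha>: "\<alpha> * (1 + \<epsilon>) * L \<le> 2"
    and r: "transpose A *v r = 0" and e: "e \<in> range ((*v) (transpose A))"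
  shows "(\<integral>\<^sup>+S. ennreal ((norm (e - \<alpha> *\<^sub>R (transpose A *v (mult_transpose S *v (A *v e + r)))))\<^sup>2) \<partial>D)
    \<le> ennreal ((1 - \<alpha> * (2 - \<alpha> * (1 + \<epsilon>) * L) * (sigma_min A)\<^sup>2) * (norm e)\<^sup>2
        + \<alpha>\<^sup>2 * (1 + 1 / \<epsilon>) * (LINT S|D. (norm (transpose A *v (mult_transpose S *v r)))\<^sup>2))"
    (is "_ \<le> ennreal (_ + _ * ?\<gamma>)")
proof -
  interpret prob_space D by fact
  have [measurable]: "mult_transpose \<in> borel_measurable D"
    using hbi by (auto elim: has_bochner_integral.cases)
  let ?\<kappa> = "\<alpha> * (2 - \<alpha> * (1 + \<epsilon>) * L)"
  note quad = has_bochner_integral_inner_matrix_vector[OF hbi]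
  \<comment> \<open>This form has finite expectation and dominates the integrand of
    \<open>gamma\<close>, which is therefore integrable too.\<close>
  have "integrable D (\<lambda>S. L * (r \<bullet> (mult_transpose S *v r)))"
    using quad[of r r] by (simp add: has_bochner_integral_iff)
  then have "integrable D (\<lambda>S. (norm (transpose A *v (mult_transpose S *v r)))\<^sup>2)"
  proof (rule Bochner_Integration.integrable_bound)
    show "AE S in D. norm ((norm (transpose A *v (mult_transpose S *v r)))\<^sup>2)
        \<le> norm (L * (r \<bullet> (mult_transpose S *v r)))"
      using L
    proof eventually_elim
      case (elim S)
      then show ?case
        using norm_transpose_mult_transpose_le[of A S L r] by auto
    qed
  qed measurable
  then have \<gamma>: "has_bochner_integral D (\<lambda>S. (norm (transpose A *v (mult_transpose S *v r)))\<^sup>2) ?\<gamma>"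
    by (simp add: has_bochner_integral_iff)
  define G where "G S = (norm e)\<^sup>2 - ?\<kappa> * ((A *v e) \<bullet> (mult_transpose S *v (A *v e)))
      - 2 * \<alpha> * ((A *v e) \<bullet> (mult_transpose S *v r))
      + \<alpha>\<^sup>2 * (1 + 1 / \<epsilon>) * (norm (transpose A *v (mult_transpose S *v r)))\<^sup>2" for S
  have const: "has_bochner_integral D (\<lambda>S. (norm e)\<^sup>2) ((norm e)\<^sup>2)"
    by (simp add: has_bochner_integral_iff prob_space)
  have "has_bochner_integral D G ((norm e)\<^sup>2 - ?\<kappa> * ((A *v e) \<bullet> (mat 1 *v (A *v e)))
      - 2 * \<alpha> * ((A *v e) \<bullet> (mat 1 *v r)) + \<alpha>\<^sup>2 * (1 + 1 / \<epsilon>) * ?\<gamma>)"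
    unfolding G_def
    by (intro has_bochner_integral_add has_bochner_integral_diff has_bochner_integral_mult_right
        const quad \<gamma>)
  moreover have "(A *v e) \<bullet> (mat 1 *v r) = 0"
    using inner_transpose_mult[of e A r] r by simp
  ultimately have G: "has_bochner_integral D G
      ((norm e)\<^sup>2 - ?\<kappa> * (norm (A *v e))\<^sup>2 + \<alpha>\<^sup>2 * (1 + 1 / \<epsilon>) * ?\<gamma>)"
    by (simp add: power2_norm_eq_inner)
  have le: "AE S in D. (norm (e - \<alpha> *\<^sub>R (transpose A *v (mult_transpose S *v (A *v e + r)))))\<^sup>2 \<le> G S"
    using L
  proof eventually_elim
    case (elim S)
    then show ?case
      unfolding G_def by (intro BRSI_step_norm_le \<open>\<epsilon> > 0\<close>) blast
  qed
  \<comment> \<open>\<open>G\<close> dominates a square; nonnegativity is needed to identify its two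
    kinds of integral.\<close>
  then have "AE S in D. 0 \<le> G S"
  proof eventually_elim
    case (elim S)
    then show ?case
      using zero_le_power2 order_trans by blast
  qed
  have "(\<integral>\<^sup>+S. ennreal ((norm (e - \<alpha> *\<^sub>R (transpose A *v (mult_transpose S *v (A *v e + r)))))\<^sup>2) \<partial>D)
      \<le> (\<integral>\<^sup>+S. ennreal (G S) \<partial>D)"
    using le by (intro nn_integral_mono_AE) (auto simp: ennreal_leI)
  also have "\<dots> = ennreal ((norm e)\<^sup>2 - ?\<kappa> * (norm (A *v e))\<^sup>2 + \<alpha>\<^sup>2 * (1 + 1 / \<epsilon>) * ?\<gamma>)"
    using G \<open>AE S in D. 0 \<le> G S\<close> by (simp add: nn_integral_eq_integral has_bochner_integral_iff)
  also have "\<dots> \<le> ennreal ((1 - ?\<kappa> * (sigma_min A)\<^sup>2) * (norm e)\<^sup>2 + \<alpha>\<^sup>2 * (1 + 1 / \<epsilon>) * ?\<gamma>)"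
  proof (rule ennreal_leI)
    \<comment> \<open>Here membership of \<open>e\<close> in the range of \<open>transpose A\<close>
      enters; the stepsize condition gives its coefficient the right sign.\<close>
    have "(sigma_min A)\<^sup>2 * (norm e)\<^sup>2 \<le> (norm (A *v e))\<^sup>2"
      using e sigma_min_bound(2)[OF \<open>A \<noteq> 0\<close>] by auto
    then have "?\<kappa> * ((sigma_min A)\<^sup>2 * (norm e)\<^sup>2) \<le> ?\<kappa> * (norm (A *v e))\<^sup>2"
      using \<open>\<alpha> > 0\<close> \<alpha> by (intro mult_left_mono) auto
    then show "(norm e)\<^sup>2 - ?\<kappa> * (norm (A *v e))\<^sup>2 + \<alpha>\<^sup>2 * (1 + 1 / \<epsilon>) * ?\<gamma>
        \<le> (1 - ?\<kappa> * (sigma_min A)\<^sup>2) * (norm e)\<^sup>2 + \<alpha>\<^sup>2 * (1 + 1 / \<epsilon>) * ?\<gamma>"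
      by (simp add: algebra_simps)
  qed
  finally show ?thesis .
qed

theorem theorem6:
  fixes A :: "real^'n^'m" and b :: "real^'m" and x0 :: "real^'n"
    and D :: "'m colmat measure"
    and P :: "'w measure" and S :: "nat \<Rightarrow> 'w \<Rightarrow> 'm colmat"
    and \<alpha> \<epsilon> :: real and k :: nat
  assumes "A \<noteq> 0"
    and "prob_space D" and "sets D = sets colmat_borel"
    and "has_bochner_integral D mult_transpose (mat 1)"
    and "\<exists>y\<in>lambda_max_values D A. \<forall>z\<in>lambda_max_values D A. z \<le> y"
    and "prob_space P"
    and "prob_space.indep_vars P (\<lambda>_. D) S UNIV"
    and "\<And>j. distr P D (S j) = D"
    and "\<epsilon> > 0" and "0 < \<alpha>" and "\<alpha> < 2 / ((1 + \<epsilon>) * lambda_max_r D A)"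
    and "\<nexists>x. A *v x = b"
  shows "integrable P (\<lambda>\<omega>. (norm (brsi A b \<alpha> x0 (\<lambda>j. S j \<omega>) k - x_star A b x0))\<^sup>2) \<and>
    (LINT \<omega>|P. (norm (brsi A b \<alpha> x0 (\<lambda>j. S j \<omega>) k - x_star A b x0))\<^sup>2)
      \<le> eta D A \<alpha> \<epsilon> ^ k * (norm (x0 - x_star A b x0))\<^sup>2
        + \<alpha> * (1 + 1 / \<epsilon>) * gamma D A b * (1 - eta D A \<alpha> \<epsilon> ^ k)
          / ((2 - \<alpha> * (1 + \<epsilon>) * lambda_max_r D A) * (sigma_min A)\<^sup>2)"
proof -
  interpret P: prob_space P by fact
  define L \<sigma> \<kappa> \<eta> r c where "L = lambda_max_r D A" and "\<sigma> = sigma_min A"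
    and "\<kappa> = 2 - \<alpha> * (1 + \<epsilon>) * L" and "\<eta> = eta D A \<alpha> \<epsilon>"
    and "r = A *v (pseudoinverse A *v b) - b"
    and "c = \<alpha>\<^sup>2 * (1 + 1 / \<epsilon>) * gamma D A b"
  define err where "err j \<omega> = brsi A b \<alpha> x0 (\<lambda>j. S j \<omega>) j - x_star A b x0" for j \<omega>
  have bound: "AE S in D. \<forall>x. (A *v x) \<bullet> (mult_transpose S *v (A *v x)) \<le> L * (norm x)\<^sup>2"
    unfolding L_def using assms by (intro AE_Rayleigh_le_lambda_max_r)
  have [measurable]: "mult_transpose \<in> borel_measurable D"
    using assms(4) by (auto elim: has_bochner_integral.cases)
  \<comment> \<open>Since division by zero yields 0, positivity of this quotient also excludes
    \<open>L = 0\<close>.\<close>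
  have "0 < 2 / ((1 + \<epsilon>) * L)"
    using assms(10,11) unfolding L_def by linarith
  then have "0 < L"
    using \<open>\<epsilon> > 0\<close> by (simp add: zero_less_divide_iff zero_less_mult_iff)
  then have "0 < (1 + \<epsilon>) * L"
    using \<open>\<epsilon> > 0\<close> by simp
  then have "\<alpha> * ((1 + \<epsilon>) * L) < 2"
    using assms(11) by (simp add: L_def pos_less_divide_eq)
  then have "\<kappa> > 0"
    by (simp add: \<kappa>_def mult_ac)
  have "\<sigma> > 0"
    unfolding \<sigma>_def by (rule sigma_min_bound(1)[OF assms(1)])
  have \<eta>: "\<eta> = 1 - \<alpha> * \<kappa> * \<sigma>\<^sup>2"
    by (simp add: \<eta>_def eta_def \<kappa>_def \<sigma>_def L_def)
  have "c \<ge> 0"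
    using \<open>\<epsilon> > 0\<close> unfolding c_def gamma_def by (intro mult_nonneg_nonneg) auto
  have "\<eta> \<ge> 0"
  proof -
    have "\<sigma>\<^sup>2 \<le> L"
      unfolding \<sigma>_def by (rule sigma_min_power2_le_bound[OF assms(1,2,4) bound])
    \<comment> \<open>This bounds \<open>\<alpha> * (2 - \<alpha> * L) * L\<close> by 1, and that
      product dominates \<open>1 - \<eta>\<close> once \<sigma> squared is replaced by
      \<open>L\<close> and \<epsilon> is dropped from \<kappa>.\<close>
    have "0 \<le> (\<alpha> * L - 1)\<^sup>2"
      by simp
    then have "\<alpha> * (2 - \<alpha> * L) * L \<le> 1"
      by (simp add: power2_eq_square algebra_simps)
    have "\<kappa> \<le> 2 - \<alpha> * L"
      using \<open>\<epsilon> > 0\<close> \<open>\<alpha> > 0\<close> \<open>L > 0\<close> by (simp add: \<kappa>_def algebra_simps)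
    then have "\<alpha> * \<kappa> * \<sigma>\<^sup>2 \<le> \<alpha> * (2 - \<alpha> * L) * L"
      using \<open>\<sigma>\<^sup>2 \<le> L\<close> \<open>\<kappa> > 0\<close> \<open>\<alpha> > 0\<close> by (intro mult_mono mult_left_mono) auto
    also have "\<dots> \<le> 1"
      by fact
    finally show ?thesis
      by (simp add: \<eta>)
  qed
  have S: "P.random_variable D (S j)" for j
    using assms(7) unfolding P.indep_vars_def by auto
  have brsi_meas: "(\<lambda>\<omega>. brsi A b \<alpha> x0 (\<lambda>j. S j \<omega>) j) \<in> borel_measurable P" for j
  proof -
    have "(\<lambda>\<omega>. \<lambda>j. S j \<omega>) \<in> measurable P (Pi\<^sub>M UNIV (\<lambda>_. D))"
      by (intro measurable_PiM_single' S) (auto intro: measurable_space[OF S])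
    from measurable_compose[OF this measurable_brsi[of D j UNIV A b \<alpha> x0]] show ?thesis
      by simp
  qed
  have [measurable]: "err j \<in> borel_measurable P" for j
    unfolding err_def using brsi_meas by measurable
  \<comment> \<open>The closed form of the recursion \<open>B (Suc j) = \<eta> * B j + c\<close>,
    with the geometric sum written through
    \<open>1 - \<eta> = \<alpha> * \<kappa> * \<sigma>\<^sup>2\<close>.\<close>
  define B where "B j = \<eta> ^ j * (norm (x0 - x_star A b x0))\<^sup>2
      + \<alpha> * (1 + 1 / \<epsilon>) * gamma D A b * (1 - \<eta> ^ j) / (\<kappa> * \<sigma>\<^sup>2)" for j
  have B_Suc: "B (Suc j) = \<eta> * B j + c" for j
  proof -
    have "(1 - \<eta>) / (\<kappa> * \<sigma>\<^sup>2) = \<alpha>"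
      using \<open>\<kappa> > 0\<close> \<open>\<sigma> > 0\<close> by (simp add: \<eta>)
    then have c: "c = \<alpha> * (1 + 1 / \<epsilon>) * gamma D A b * ((1 - \<eta>) / (\<kappa> * \<sigma>\<^sup>2))"
      by (simp add: c_def power2_eq_square)
    show ?thesis
      unfolding B_def c by (simp add: algebra_simps diff_divide_distrib add_divide_distrib)
  qed
  have B_nonneg: "B j \<ge> 0" for j
  proof (induction j)
    case (Suc j)
    then show ?case
      unfolding B_Suc using \<open>\<eta> \<ge> 0\<close> \<open>c \<ge> 0\<close> by simp
  qed (simp add: B_def)
  \<comment> \<open>The induction runs on nonnegative integrals, so that integrability of the
    squared error is a result and not a premise.\<close>
  have main: "(\<integral>\<^sup>+\<omega>. ennreal ((norm (err j \<omega>))\<^sup>2) \<partial>P) \<le> ennreal (B j)" for j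
  proof (induction j)
    case 0
    then show ?case
      by (simp add: err_def B_def P.emeasure_space_1)
  next
    case (Suc j)
    \<comment> \<open>One step, as a function of the past samples \<open>s\<close> and the fresh
      sample \<open>T\<close>.\<close>
    define F where "F = (\<lambda>(s, T). ennreal ((norm ((brsi A b \<alpha> x0 s j - x_star A b x0)
        - \<alpha> *\<^sub>R (transpose A *v (mult_transpose T *v
            (A *v (brsi A b \<alpha> x0 s j - x_star A b x0) + r)))))\<^sup>2))"
    have [measurable]: "(\<lambda>s. brsi A b \<alpha> x0 s j) \<in> borel_measurable (Pi\<^sub>M {..<j} (\<lambda>_. D))"
      by (rule measurable_brsi) auto
    have F: "F \<in> borel_measurable (Pi\<^sub>M {..<j} (\<lambda>_. D) \<Otimes>\<^sub>M D)"
      unfolding F_def by measurable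
    have past: "brsi A b \<alpha> x0 (restrict (\<lambda>i. S i \<omega>) {..<j}) j = brsi A b \<alpha> x0 (\<lambda>i. S i \<omega>) j" for \<omega>
      by (rule brsi_cong) simp
    have "(\<integral>\<^sup>+\<omega>. ennreal ((norm (err (Suc j) \<omega>))\<^sup>2) \<partial>P)
        = (\<integral>\<^sup>+\<omega>. F (restrict (\<lambda>i. S i \<omega>) {..<j}, S j \<omega>) \<partial>P)"
      unfolding err_def F_def brsi_error_Suc r_def by (simp add: past)
    also have "\<dots> = (\<integral>\<^sup>+\<omega>. \<integral>\<^sup>+T. F (restrict (\<lambda>i. S i \<omega>) {..<j}, T) \<partial>D \<partial>P)"
      using P.nn_integral_indep_vars_lessThan[OF assms(7) F] by (simp add: assms(8))
    also have "\<dots> \<le> (\<integral>\<^sup>+\<omega>. ennreal (\<eta> * (norm (err j \<omega>))\<^sup>2 + c) \<partial>P)"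
    proof (rule nn_integral_mono)
      fix \<omega>
      have "gamma D A b = (LINT S|D. (norm (transpose A *v (mult_transpose S *v r)))\<^sup>2)"
        by (simp add: gamma_def r_def flip: matrix_vector_mul_assoc)
      then show "(\<integral>\<^sup>+T. F (restrict (\<lambda>i. S i \<omega>) {..<j}, T) \<partial>D) \<le> ennreal (\<eta> * (norm (err j \<omega>))\<^sup>2 + c)"
        using nn_integral_BRSI_step_le[OF assms(1,2,4) bound \<open>\<epsilon> > 0\<close> \<open>\<alpha> > 0\<close> _
            transpose_residual_eq_0[of A b] brsi_error_in_range_transpose] \<open>\<kappa> > 0\<close>
        by (simp add: F_def past \<eta> err_def c_def \<kappa>_def \<sigma>_def r_def)
    qed
    also have "\<dots> = ennreal \<eta> * (\<integral>\<^sup>+\<omega>. ennreal ((norm (err j \<omega>))\<^sup>2) \<partial>P) + ennreal c"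
      using \<open>\<eta> \<ge> 0\<close> \<open>c \<ge> 0\<close>
      by (simp add: ennreal_mult nn_integral_add nn_integral_cmult P.emeasure_space_1)
    also have "\<dots> \<le> ennreal \<eta> * ennreal (B j) + ennreal c"
      by (intro add_mono mult_left_mono Suc.IH) auto
    also have "\<dots> = ennreal (B (Suc j))"
      using \<open>\<eta> \<ge> 0\<close> \<open>c \<ge> 0\<close> B_nonneg by (simp add: B_Suc ennreal_mult)
    finally show ?case .
  qed
  \<comment> \<open>Finiteness of the nonnegative integral gives integrability, so the expectation
    below is a genuine one and not the default value 0.\<close>
  have int: "integrable P (\<lambda>\<omega>. (norm (err k \<omega>))\<^sup>2)"
    using main[of k] by (intro integrableI_bounded) (auto intro: le_less_trans)
  then have "ennreal (LINT \<omega>|P. (norm (err k \<omega>))\<^sup>2) \<le> ennreal (B k)"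
    using main[of k] by (simp add: nn_integral_eq_integral)
  then have "(LINT \<omega>|P. (norm (err k \<omega>))\<^sup>2) \<le> B k"
    using B_nonneg by simp
  with int show ?thesis
    by (simp add: err_def B_def \<kappa>_def L_def \<eta>_def \<sigma>_def)
qed

end
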